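(* Let $(X,\underline{*},\overline{*})$ be a biquandle, and let $\underline{*}^{[n]},\overline{*}^{[n]}$ ($n\in\mathbb{Z}$) be its $n$-parallel biquandle operations. Then $(X,(\underline{*}^{[n]})_{n\in\mathbb{Z}},(\overline{*}^{[n]})_{n\in\mathbb{Z}})$ is a $\mathbb{Z}$-family of biquandles.
   Context: A biquandle is a non-empty set $X$ with binary operations $\underline{*},\overline{*}:X\times X\to X$ such that: (B1) $x\underline{*}x=x\overline{*}x$ for all $x$; (B2) for every $a\in X$ the maps $x\mapsto x\underline{*}a$ and $x\mapsto x\overline{*}a$ are bijections $X\to X$, and $S:X\times X\to X\times X$, $S(x,y)=(y\overline{*}x,x\underline{*}y)$ is bijective; (B3) for all $x,y,z$: $(x\underline{*}y)\underline{*}(z\underline{*}y)=(x\underline{*}z)\underline{*}(y\overline{*}z)$, $(x\underline{*}y)\overline{*}(z\underline{*}y)=(x\overline{*}z)\underline{*}(y\overline{*}z)$, $(x\overline{*}y)\overline{*}(z\overline{*}y)=(x\overline{*}z)\overline{*}(y\underline{*}z)$. The $n$-parallel biquandle operations are the two (well-defined) families of binary operations $\underline{*}^{[n]},\overline{*}^{[n]}:X\times X\to X$, $n\in\mathbb{Z}$, determined by the equalities $a\underline{*}^{[0]}b=a$, $a\underline{*}^{[1]}b=a\underline{*}b$, $a\underline{*}^{[i+j]}b=(a\underline{*}^{[i]}b)\underline{*}^{[j]}(b\underline{*}^{[i]}b)$, $a\overline{*}^{[0]}b=a$, $a\overline{*}^{[1]}b=a\overline{*}b$, $a\overline{*}^{[i+j]}b=(a\overline{*}^{[i]}b)\overline{*}^{[j]}(b\overline{*}^{[i]}b)$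 for all $a,b\in X$ and $i,j\in\mathbb{Z}$. For a group $G$ with identity $e$, a $G$-family of biquandles is a non-empty set $X$ with two families of binary operations $\underline{*}^g,\overline{*}^g:X\times X\to X$ ($g\in G$) such that for all $x,y,z\in X$ and $g,h\in G$: - $(x\underline{*}^gy)\underline{*}^h(z\overline{*}^gy)=(x\underline{*}^hz)\underline{*}^{h^{-1}gh}(y\underline{*}^hz)$, - $(x\overline{*}^gy)\underline{*}^h(z\overline{*}^gy)=(x\underline{*}^hz)\overline{*}^{h^{-1}gh}(y\underline{*}^hz)$, - $(x\overline{*}^gy)\overline{*}^h(z\overline{*}^gy)=(x\overline{*}^hz)\overline{*}^{h^{-1}gh}(y\underline{*}^hz)$, - $x\underline{*}^{gh}y=(x\underline{*}^gy)\underline{*}^h(y\underline{*}^gy)$ and $x\underline{*}^ey=x$, - $x\overline{*}^{gh}y=(x\overline{*}^gy)\overline{*}^h(y\overline{*}^gy)$ and $x\overline{*}^ey=x$, - $x\underline{*}^gx=x\overline{*}^gx$. Here $G=\mathbb{Z}$ is the additive group of integers (so $gh$ is $g+h$ and $e=0$). *)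

theory Defs
  imports "HOL-Algebra.Elementary_Groups" "HOL-Library.FuncSet"
begin

text \<open>
  \<open>x \<triangleright> y\<close> is the operation written with an underlined star, \<open>x \<triangleleft> y\<close> the one with an overlined star.
\<close>

locale biquandle =
  fixes X :: "'a set"
    and under :: "'a \<Rightarrow> 'a \<Rightarrow> 'a"  (infixl "\<triangleright>" 70)
    and over :: "'a \<Rightarrow> 'a \<Rightarrow> 'a"  (infixl "\<triangleleft>" 70)
  assumes nonempty: "X \<noteq> {}"
    and under_closed: "\<lbrakk>x \<in> X; y \<in> X\<rbrakk> \<Longrightarrow> x \<triangleright> y \<in> X"
    and over_closed: "\<lbrakk>x \<in> X; y \<in> X\<rbrakk> \<Longrightarrow> x \<triangleleft> y \<in> X"
    and diag: "x \<in> X \<Longrightarrow> x \<triangleright> x = x \<triangleleft> x"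
    and bij_under: "a \<in> X \<Longrightarrow> bij_betw (\<lambda>x. x \<triangleright> a) X X"
    and bij_over: "a \<in> X \<Longrightarrow> bij_betw (\<lambda>x. x \<triangleleft> a) X X"
    and bij_S: "bij_betw (\<lambda>(x, y). (y \<triangleleft> x, x \<triangleright> y)) (X \<times> X) (X \<times> X)"
    and exchange_uu: "\<lbrakk>x \<in> X; y \<in> X; z \<in> X\<rbrakk> \<Longrightarrow>
          (x \<triangleright> y) \<triangleright> (z \<triangleright> y) = (x \<triangleright> z) \<triangleright> (y \<triangleleft> z)"
    and exchange_uo: "\<lbrakk>x \<in> X; y \<in> X; z \<in> X\<rbrakk> \<Longrightarrow>
          (x \<triangleright> y) \<triangleleft> (z \<triangleright> y) = (x \<triangleleft> z) \<triangleright> (y \<triangleleft> z)"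
    and exchange_oo: "\<lbrakk>x \<in> X; y \<in> X; z \<in> X\<rbrakk> \<Longrightarrow>
          (x \<triangleleft> y) \<triangleleft> (z \<triangleleft> y) = (x \<triangleleft> z) \<triangleleft> (y \<triangleright> z)"

locale G_family_of_biquandles = group G for G :: "('g, 'm) monoid_scheme" (structure) +
  fixes X :: "'a set"
    and under :: "'g \<Rightarrow> 'a \<Rightarrow> 'a \<Rightarrow> 'a"
    and over :: "'g \<Rightarrow> 'a \<Rightarrow> 'a \<Rightarrow> 'a"
  assumes nonempty: "X \<noteq> {}"
    and under_closed: "\<lbrakk>g \<in> carrier G; x \<in> X; y \<in> X\<rbrakk> \<Longrightarrow> under g x y \<in> X"
    and over_closed: "\<lbrakk>g \<in> carrier G; x \<in> X; y \<in> X\<rbrakk> \<Longrightarrow> over g x y \<in> X"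
    and exchange_uu: "\<lbrakk>g \<in> carrier G; h \<in> carrier G; x \<in> X; y \<in> X; z \<in> X\<rbrakk> \<Longrightarrow>
          under h (under g x y) (over g z y)
          = under (inv h \<otimes> g \<otimes> h) (under h x z) (under h y z)"
    and exchange_ou: "\<lbrakk>g \<in> carrier G; h \<in> carrier G; x \<in> X; y \<in> X; z \<in> X\<rbrakk> \<Longrightarrow>
          under h (over g x y) (over g z y)
          = over (inv h \<otimes> g \<otimes> h) (under h x z) (under h y z)"
    and exchange_oo: "\<lbrakk>g \<in> carrier G; h \<in> carrier G; x \<in> X; y \<in> X; z \<in> X\<rbrakk> \<Longrightarrow>
          over h (over g x y) (over g z y)
          = over (inv h \<otimes> g \<otimes> h) (over h x z) (under h y z)"
    and under_mult: "\<lbrakk>g \<in> carrier G; h \<in> carrier G; x \<in> X; y \<in> X\<rbrakk> \<Longrightarrow>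
          under (g \<otimes> h) x y = under h (under g x y) (under g y y)"
    and under_one: "\<lbrakk>x \<in> X; y \<in> X\<rbrakk> \<Longrightarrow> under \<one> x y = x"
    and over_mult: "\<lbrakk>g \<in> carrier G; h \<in> carrier G; x \<in> X; y \<in> X\<rbrakk> \<Longrightarrow>
          over (g \<otimes> h) x y = over h (over g x y) (over g y y)"
    and over_one: "\<lbrakk>x \<in> X; y \<in> X\<rbrakk> \<Longrightarrow> over \<one> x y = x"
    and diag: "\<lbrakk>g \<in> carrier G; x \<in> X\<rbrakk> \<Longrightarrow> under g x x = over g x x"

definition is_parallel_family ::
    "'a set \<Rightarrow> ('a \<Rightarrow> 'a \<Rightarrow> 'a) \<Rightarrow> (int \<Rightarrow> 'a \<Rightarrow> 'a \<Rightarrow> 'a) \<Rightarrow> bool" where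
  "is_parallel_family X f F \<longleftrightarrow>
     (\<forall>n. F n \<in> X \<rightarrow>\<^sub>E X \<rightarrow>\<^sub>E X) \<and>
     (\<forall>a\<in>X. \<forall>b\<in>X. F 0 a b = a) \<and>
     (\<forall>a\<in>X. \<forall>b\<in>X. F 1 a b = f a b) \<and>
     (\<forall>i j. \<forall>a\<in>X. \<forall>b\<in>X. F (i + j) a b = F j (F i a b) (F i b b))"

text \<open>
  The parallel operations are the unique family satisfying these equalities; requiring each
  member to be an extensional function makes the family unique also as a HOL function. The
  definition is meaningful when \<open>f\<close> is either operation of a biquandle on \<open>X\<close>; otherwise such a
  family need not exist or be unique.
\<close>

definition parallel_op ::
    "'a set \<Rightarrow> ('a \<Rightarrow> 'a \<Rightarrow> 'a) \<Rightarrow> int \<Rightarrow> 'a \<Rightarrow> 'a \<Rightarrow> 'a" where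
  "parallel_op X f = (THE F. is_parallel_family X f F)"

end

theory Submission
  imports Defs "HOL-Algebra.Bij"
begin

text \<open>
  For a binary operation \<open>f\<close> on \<open>X\<close> put \<open>T (a, b) = (f a b, f b b)\<close>. The parallel operations of
  \<open>f\<close> exist and are unique as soon as \<open>T\<close> is a bijection, because they are the first components
  of the integer powers of \<open>T\<close>. For \<open>\<triangleright>\<close> and \<open>\<triangleleft>\<close> this requires the squaring map to be onto:
  given \<open>a\<close>, choose \<open>x, y\<close> with \<open>y \<triangleleft> x = a = x \<triangleright> y\<close>; then \<open>a \<triangleright> a = (x \<triangleright> x) \<triangleright> a\<close> by the first
  exchange law, so \<open>a = x \<triangleright> x\<close>. Each of the three exchange laws of the family, with exponents \<open>g\<close>
  and \<open>h\<close>, says that \<open>V\<^sup>g\<close> and \<open>H\<^sup>h\<close> commute for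
  \<open>V (x, y, z) = (x * y, y * y, z \<triangleleft> y)\<close> and \<open>H (x, y, z) = (x \<star> z, y \<triangleright> z, z \<star> z)\<close>, where \<open>*\<close> and
  \<open>\<star>\<close> are suitable choices among \<open>\<triangleright>\<close> and \<open>\<triangleleft>\<close>. It therefore suffices that \<open>V\<close> and \<open>H\<close> commute,
  which is the exchange law of the biquandle.
\<close>

section \<open>Actions of the integers on a set\<close>

locale int_action =
  fixes Y :: "'b set" and \<Phi> :: "int \<Rightarrow> 'b \<Rightarrow> 'b"
  assumes closed: "y \<in> Y \<Longrightarrow> \<Phi> n y \<in> Y"
    and zero: "y \<in> Y \<Longrightarrow> \<Phi> 0 y = y"
    and add: "y \<in> Y \<Longrightarrow> \<Phi> (i + j) y = \<Phi> j (\<Phi> i y)"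

text \<open>The element 1 generates the integers, so equivariance under \<open>\<Phi> 1\<close>
  spreads to every exponent by induction in both directions.\<close>

lemma int_action_intertwine:
  assumes "int_action Y \<Phi>" and "int_action Z \<Psi>"
    and maps: "\<And>y. y \<in> Y \<Longrightarrow> \<psi> y \<in> Z"
    and gen: "\<And>y. y \<in> Y \<Longrightarrow> \<psi> (\<Phi> 1 y) = \<Psi> 1 (\<psi> y)"
    and "y \<in> Y"
  shows "\<psi> (\<Phi> n y) = \<Psi> n (\<psi> y)"
proof -
  interpret Y: int_action Y \<Phi> by fact
  interpret Z: int_action Z \<Psi> by fact
  show ?thesis
    using \<open>y \<in> Y\<close>
  proof (induction n arbitrary: y rule: int_induct[where k = 0])
    case base
    then show ?case by (simp add: Y.zero Z.zero maps)
  next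
    case (step1 i)
    then show ?case by (simp add: Y.add Z.add Y.closed maps gen)
  next
    case (step2 i)
    \<comment> \<open>The point \<open>w\<close> is the preimage of \<open>y\<close> under
      \<open>\<Phi> 1\<close>. The hypothesis at \<open>i\<close>, applied to \<open>w\<close>
      instead of \<open>y\<close>, gives the claim at \<open>i - 1\<close>.\<close>
    define w where "w = \<Phi> (- 1) y"
    have w: "w \<in> Y" "\<Phi> 1 w = y"
      using step2.prems Y.add[of y "- 1" 1] by (auto simp: w_def Y.closed Y.zero)
    have "\<psi> (\<Phi> (i - 1) y) = \<psi> (\<Phi> i w)"
      using Y.add[OF w(1), of 1 "i - 1"] w(2) by simp
    also have "\<dots> = \<Psi> i (\<psi> w)"
      using step2.IH w(1) .
    also have "\<dots> = \<Psi> (i - 1) (\<psi> y)"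
      using Z.add[OF maps[OF w(1)], of 1 "i - 1"] gen[OF w(1)] w(2) by simp
    finally show ?case .
  qed
qed

lemma int_action_unique:
  assumes "int_action Y \<Phi>" and "int_action Y \<Psi>"
    and "\<And>y. y \<in> Y \<Longrightarrow> \<Phi> 1 y = \<Psi> 1 y" and "y \<in> Y"
  shows "\<Phi> n y = \<Psi> n y"
  using int_action_intertwine[of Y \<Phi> Y \<Psi> "\<lambda>y. y"] assms by blast

text \<open>Intertwining is used twice: \<open>\<Phi> 1\<close> is an endomorphism of the action
  \<open>\<Psi>\<close>, hence each \<open>\<Psi> h\<close> is an endomorphism of the action
  \<open>\<Phi>\<close>.\<close>

lemma int_action_commute:
  assumes \<Phi>: "int_action Y \<Phi>" and \<Psi>: "int_action Y \<Psi>"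
    and gen: "\<And>y. y \<in> Y \<Longrightarrow> \<Psi> 1 (\<Phi> 1 y) = \<Phi> 1 (\<Psi> 1 y)" and "y \<in> Y"
  shows "\<Psi> h (\<Phi> g y) = \<Phi> g (\<Psi> h y)"
proof -
  have closed: "\<Phi> n y \<in> Y" "\<Psi> n y \<in> Y" if "y \<in> Y" for n y
    using that \<Phi> \<Psi> by (auto intro: int_action.closed)
  have "\<Phi> 1 (\<Psi> h y) = \<Psi> h (\<Phi> 1 y)" if "y \<in> Y" for y
    using int_action_intertwine[OF \<Psi> \<Psi>, of "\<Phi> 1"] closed gen that by simp
  then show ?thesis
    using int_action_intertwine[OF \<Phi> \<Phi>, of "\<Psi> h"] closed \<open>y \<in> Y\<close> by simp
qed

lemma BijGroup_carrier: "carrier (BijGroup Y) = Bij Y"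
  by (simp add: BijGroup_def)

lemma BijGroup_mult:
  assumes "f \<in> Bij Y" and "g \<in> Bij Y"
  shows "f \<otimes>\<^bsub>BijGroup Y\<^esub> g = compose Y f g"
  using assms by (simp add: BijGroup_def)

lemma int_action_powers:
  assumes "t \<in> Bij Y"
  shows "int_action Y (\<lambda>n. t [^]\<^bsub>BijGroup Y\<^esub> n)"
proof -
  interpret group "BijGroup Y" by (rule group_BijGroup)
  have t: "t \<in> carrier (BijGroup Y)"
    using assms by (simp add: BijGroup_carrier)
  then have Bij: "t [^]\<^bsub>BijGroup Y\<^esub> n \<in> Bij Y" for n :: int
    using int_pow_closed[OF t] by (simp add: BijGroup_carrier)
  show ?thesis
  proof
    fix y and n :: int
    assume "y \<in> Y"
    then show "(t [^]\<^bsub>BijGroup Y\<^esub> n) y \<in> Y"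
      using Bij[of n] Bij_imp_funcset by blast
  next
    fix y assume "y \<in> Y"
    then show "(t [^]\<^bsub>BijGroup Y\<^esub> (0 :: int)) y = y"
      by (simp add: BijGroup_def)
  next
    fix y and i j :: int
    assume "y \<in> Y"
    \<comment> \<open>A product in \<open>BijGroup\<close> applies its right factor first, so the
      exponents are swapped to let \<open>i\<close> act before \<open>j\<close>.\<close>
    have "t [^]\<^bsub>BijGroup Y\<^esub> (i + j) = t [^]\<^bsub>BijGroup Y\<^esub> j \<otimes>\<^bsub>BijGroup Y\<^esub> t [^]\<^bsub>BijGroup Y\<^esub> i"
      using int_pow_mult[OF t, of j i] by (simp only: add.commute)
    also have "\<dots> = compose Y (t [^]\<^bsub>BijGroup Y\<^esub> j) (t [^]\<^bsub>BijGroup Y\<^esub> i)"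
      by (rule BijGroup_mult[OF Bij Bij])
    finally show "(t [^]\<^bsub>BijGroup Y\<^esub> (i + j)) y = (t [^]\<^bsub>BijGroup Y\<^esub> j) ((t [^]\<^bsub>BijGroup Y\<^esub> i) y)"
      using \<open>y \<in> Y\<close> by (simp add: compose_eq)
  qed
qed

section \<open>Families of parallel operations\<close>

lemma parallel_family_simps:
  assumes "is_parallel_family X f F" "a \<in> X" "b \<in> X"
  shows "F n a b \<in> X" "F 0 a b = a" "F 1 a b = f a b" "F (i + j) a b = F j (F i a b) (F i b b)"
  using assms unfolding is_parallel_family_def by (auto dest!: spec[of _ n] simp: PiE_iff)

text \<open>The recursion for \<open>F (i + j)\<close> changes both arguments. Carrying
  \<open>F n b b\<close> along as a second component turns it into the law of an action.\<close>

lemma parallel_family_pair_action: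
  assumes "is_parallel_family X f F"
  shows "int_action (X \<times> X) (\<lambda>n (a, b). (F n a b, F n b b))"
  using parallel_family_simps[OF assms] by unfold_locales auto

lemma parallel_family_unique:
  assumes F: "is_parallel_family X f F" and F': "is_parallel_family X f F'"
  shows "F = F'"
proof
  fix n
  have eq: "F n a b = F' n a b" if "a \<in> X" "b \<in> X" for a b
    using int_action_unique[OF parallel_family_pair_action[OF F] parallel_family_pair_action[OF F'],
        of "(a, b)" n] that parallel_family_simps(3)[OF F] parallel_family_simps(3)[OF F']
    by auto
  have ext: "F n \<in> X \<rightarrow>\<^sub>E X \<rightarrow>\<^sub>E X" "F' n \<in> X \<rightarrow>\<^sub>E X \<rightarrow>\<^sub>E X"
    using F F' by (auto simp: is_parallel_family_def)
  show "F n = F' n"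
  proof (rule PiE_ext[OF ext])
    fix a assume "a \<in> X"
    show "F n a = F' n a"
      by (rule PiE_ext[OF PiE_mem[OF ext(1)] PiE_mem[OF ext(2)]]) (use eq \<open>a \<in> X\<close> in auto)
  qed
qed

text \<open>Under these hypotheses \<open>t\<close> is invertible: \<open>b\<close> is recovered
  from \<open>f b b\<close>, and then \<open>a\<close> from \<open>f a b\<close>. The family is read
  off from the integer powers of \<open>t\<close>.\<close>

lemma parallel_family_exists:
  assumes bij: "\<And>b. b \<in> X \<Longrightarrow> bij_betw (\<lambda>a. f a b) X X"
    and bij_diag: "bij_betw (\<lambda>b. f b b) X X"
  shows "\<exists>F. is_parallel_family X f F"
proof -
  define t where "t = restrict (\<lambda>(a, b). (f a b, f b b)) (X \<times> X)"
  have t: "t (a, b) = (f a b, f b b)" if "a \<in> X" "b \<in> X" for a b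
    using that by (simp add: t_def)
  have f_closed: "f a b \<in> X" if "a \<in> X" "b \<in> X" for a b
    using bij_betw_apply[OF bij[OF that(2)] that(1)] .
  have "inj_on t (X \<times> X)"
  proof (rule inj_onI, clarify)
    fix a b a' b'
    assume *: "a \<in> X" "b \<in> X" "a' \<in> X" "b' \<in> X" "t (a, b) = t (a', b')"
    then have eq: "f a b = f a' b'" "f b b = f b' b'"
      by (simp_all add: t)
    have "b = b'"
      by (rule inj_onD[OF bij_betw_imp_inj_on[OF bij_diag] eq(2)]) fact+
    moreover have "a = a'"
      by (rule inj_onD[OF bij_betw_imp_inj_on[OF bij[of b]]]) (use * eq \<open>b = b'\<close> in simp_all)
    ultimately show "a = a' \<and> b = b'" by simp
  qed
  moreover have "t ` (X \<times> X) = X \<times> X"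
  proof
    show "t ` (X \<times> X) \<subseteq> X \<times> X" by (auto simp: t f_closed)
    show "X \<times> X \<subseteq> t ` (X \<times> X)"
    proof clarify
      fix c d assume "c \<in> X" "d \<in> X"
      from \<open>d \<in> X\<close> have "d \<in> (\<lambda>b. f b b) ` X"
        by (simp only: bij_betw_imp_surj_on[OF bij_diag])
      then obtain b where b: "d = f b b" "b \<in> X"
        by (rule imageE)
      from \<open>c \<in> X\<close> have "c \<in> (\<lambda>a. f a b) ` X"
        by (simp only: bij_betw_imp_surj_on[OF bij[OF b(2)]])
      then obtain a where a: "c = f a b" "a \<in> X"
        by (rule imageE)
      show "(c, d) \<in> t ` (X \<times> X)"
        by (rule image_eqI[of _ _ "(a, b)"]) (simp_all add: a b t)
    qed
  qed
  ultimately have "t \<in> Bij (X \<times> X)"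
    by (simp add: Bij_def bij_betw_def t_def)
  define P where "P = (\<lambda>n :: int. t [^]\<^bsub>BijGroup (X \<times> X)\<^esub> n)"
  have P: "int_action (X \<times> X) P"
    unfolding P_def by (rule int_action_powers) fact
  interpret int_action "X \<times> X" P by (rule P)
  have P1: "P 1 y = t y" for y
  proof -
    interpret group "BijGroup (X \<times> X)" by (rule group_BijGroup)
    show ?thesis
      using int_pow_1[of t] \<open>t \<in> Bij (X \<times> X)\<close> unfolding P_def by (simp add: BijGroup_carrier)
  qed
  \<comment> \<open>The map sending \<open>(a, b)\<close> to \<open>(b, b)\<close> commutes with
    \<open>t\<close>, hence with all its powers. Thus the second component of
    \<open>P n (a, b)\<close> is the parallel operation applied to \<open>b\<close> and
    \<open>b\<close>.\<close>
  have diag: "fst (P n (b, b)) = snd (P n (a, b))" if "a \<in> X" "b \<in> X" for n a b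
  proof -
    have "(\<lambda>y. (snd y, snd y)) (P n (a, b)) = P n ((\<lambda>y. (snd y, snd y)) (a, b))"
      by (rule int_action_intertwine[OF P P]) (use that in \<open>auto simp: P1 t\<close>)
    then show ?thesis by (metis fst_conv snd_conv)
  qed
  define F where "F = (\<lambda>n. \<lambda>a\<in>X. \<lambda>b\<in>X. fst (P n (a, b)))"
  have F: "F n a b = fst (P n (a, b))" if "a \<in> X" "b \<in> X" for n a b
    using that by (simp add: F_def)
  have closed_fst: "fst (P n (a, b)) \<in> X" if "a \<in> X" "b \<in> X" for n a b
    using closed[of "(a, b)" n] that by auto
  have "is_parallel_family X f F"
    unfolding is_parallel_family_def
  proof (intro conjI allI ballI)
    fix n show "F n \<in> X \<rightarrow>\<^sub>E X \<rightarrow>\<^sub>E X"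
      using closed_fst by (auto simp: F_def)
  next
    fix a b assume "a \<in> X" "b \<in> X"
    then show "F 0 a b = a" "F 1 a b = f a b"
      by (simp_all add: F zero P1 t)
  next
    fix i j a b assume ab: "a \<in> X" "b \<in> X"
    have "P i (a, b) = (F i a b, F i b b)"
      using ab by (simp add: F diag prod_eq_iff)
    moreover have "F i a b \<in> X" "F i b b \<in> X"
      using ab by (simp_all add: F closed_fst)
    ultimately show "F (i + j) a b = F j (F i a b) (F i b b)"
      using ab add[of "(a, b)" i j] by (simp add: F)
  qed
  then show ?thesis by blast
qed

lemma parallel_op_is_parallel_family:
  assumes "\<And>b. b \<in> X \<Longrightarrow> bij_betw (\<lambda>a. f a b) X X" and "bij_betw (\<lambda>b. f b b) X X"
  shows "is_parallel_family X f (parallel_op X f)"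
proof -
  have "\<exists>!F. is_parallel_family X f F"
    using parallel_family_exists[OF assms] parallel_family_unique by blast
  then show ?thesis
    unfolding parallel_op_def by (rule theI')
qed

text \<open>On the diagonal a parallel family is an action on \<open>X\<close> itself, generated by
  the squaring map, so equal squaring maps give equal actions.\<close>

lemma parallel_family_diag_eq:
  assumes F: "is_parallel_family X f F" and F': "is_parallel_family X f' F'"
    and eq: "\<And>x. x \<in> X \<Longrightarrow> f x x = f' x x" and "x \<in> X"
  shows "F n x x = F' n x x"
proof -
  have "int_action X (\<lambda>n x. F n x x)" "int_action X (\<lambda>n x. F' n x x)"
    using parallel_family_simps[OF F] parallel_family_simps[OF F'] by unfold_locales auto
  then show ?thesis
    by (rule int_action_unique)
      (use assms parallel_family_simps(3)[OF F] parallel_family_simps(3)[OF F'] in auto)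
qed

text \<open>Four families cover all three exchange laws at once. The hypotheses
  \<open>exchange\<close>, \<open>exchange_d\<close> and \<open>exchange_c\<close> are the three
  components of the statement that \<open>V 1\<close> and \<open>H 1\<close> commute.\<close>

lemma parallel_family_exchange:
  assumes A: "is_parallel_family X a A" and B: "is_parallel_family X b B"
    and C: "is_parallel_family X c C" and D: "is_parallel_family X d D"
    and ab: "\<And>x. x \<in> X \<Longrightarrow> a x x = b x x"
    and ac: "\<And>x. x \<in> X \<Longrightarrow> a x x = c x x"
    and ad: "\<And>x. x \<in> X \<Longrightarrow> a x x = d x x"
    and exchange:
      "\<And>x y z. \<lbrakk>x \<in> X; y \<in> X; z \<in> X\<rbrakk> \<Longrightarrow> b (a x y) (c z y) = a (b x z) (d y z)"
    and exchange_d: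
      "\<And>y z. \<lbrakk>y \<in> X; z \<in> X\<rbrakk> \<Longrightarrow> d (a y y) (c z y) = a (d y z) (d y z)"
    and exchange_c:
      "\<And>y z. \<lbrakk>y \<in> X; z \<in> X\<rbrakk> \<Longrightarrow> b (c z y) (c z y) = c (b z z) (d y z)"
    and xyz: "x \<in> X" "y \<in> X" "z \<in> X"
  shows "B h (A g x y) (C g z y) = A g (B h x z) (D h y z)"
proof -
  note simps = parallel_family_simps[OF A] parallel_family_simps[OF B]
    parallel_family_simps[OF C] parallel_family_simps[OF D]
  have AC: "A n x x = C n x x" if "x \<in> X" for n x
    using parallel_family_diag_eq[OF A C ac that] .
  have BD: "B n x x = D n x x" if "x \<in> X" for n x
    using parallel_family_diag_eq[OF B D _ that] ab ad by metis
  define V where "V = (\<lambda>g (x, y, z). (A g x y, A g y y, C g z y))"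
  define H where "H = (\<lambda>h (x, y, z). (B h x z, D h y z, B h z z))"
  \<comment> \<open>Additivity in the third component needs \<open>A\<close> and \<open>C\<close> to
    agree on the diagonal; for \<open>H\<close> below, the second component needs this of
    \<open>B\<close> and \<open>D\<close>.\<close>
  have "int_action (X \<times> X \<times> X) V"
    unfolding V_def using simps AC by unfold_locales auto
  moreover have "int_action (X \<times> X \<times> X) H"
    unfolding H_def using simps BD by unfold_locales auto
  moreover have "H 1 (V 1 w) = V 1 (H 1 w)" if "w \<in> X \<times> X \<times> X" for w
  proof -
    have cl: "a x y \<in> X" "b x y \<in> X" "c x y \<in> X" "d x y \<in> X" if "x \<in> X" "y \<in> X" for x y
      using simps(1,3,5,7,9,11,13,15) that by metis+
    show ?thesis
      using that by (auto simp: V_def H_def simps cl exchange exchange_d exchange_c)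
  qed
  ultimately have "H h (V g (x, y, z)) = V g (H h (x, y, z))"
    by (rule int_action_commute) (use xyz in auto)
  then show ?thesis
    by (simp add: V_def H_def)
qed

section \<open>Biquandles and their parallel operations\<close>

lemma (in biquandle) bij_diag: "bij_betw (\<lambda>x. x \<triangleright> x) X X"
  unfolding bij_betw_def
proof
  show "inj_on (\<lambda>x. x \<triangleright> x) X"
  proof (rule inj_onI)
    fix x y assume "x \<in> X" "y \<in> X" "x \<triangleright> x = y \<triangleright> y"
    \<comment> \<open>Both components of the image of \<open>(x, x)\<close> under the bijection of
      \<open>bij_S\<close> are the square of \<open>x\<close>, so equal squares force equal
      points.\<close>
    then show "x = y"
      using inj_onD[OF bij_betw_imp_inj_on[OF bij_S], of "(x, x)" "(y, y)"] diag by simp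
  qed
  show "(\<lambda>x. x \<triangleright> x) ` X = X"
  proof
    show "(\<lambda>x. x \<triangleright> x) ` X \<subseteq> X" by (auto simp: under_closed)
    show "X \<subseteq> (\<lambda>x. x \<triangleright> x) ` X"
    proof
      fix a assume a: "a \<in> X"
      then have "(a, a) \<in> (\<lambda>(x, y). (y \<triangleleft> x, x \<triangleright> y)) ` (X \<times> X)"
        using bij_betw_imp_surj_on[OF bij_S] by blast
      then obtain x y where xy: "x \<in> X" "y \<in> X" "y \<triangleleft> x = a" "x \<triangleright> y = a"
        by auto
      \<comment> \<open>This is the first exchange law with \<open>z = x\<close>; the right factor
        \<open>a\<close> is cancelled next.\<close>
      have "a \<triangleright> a = (x \<triangleright> x) \<triangleright> a"
        using exchange_uu[of x y x] xy by simp
      then have "a = x \<triangleright> x"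
        using inj_onD[OF bij_betw_imp_inj_on[OF bij_under[OF a]]] a xy(1) under_closed by blast
      then show "a \<in> (\<lambda>x. x \<triangleright> x) ` X"
        using xy(1) by blast
    qed
  qed
qed

theorem proposition9p3:
  fixes X :: "'a set" and under over :: "'a \<Rightarrow> 'a \<Rightarrow> 'a"
  assumes "biquandle X under over"
  shows "G_family_of_biquandles integer_group X (parallel_op X under) (parallel_op X over)"
proof -
  interpret biquandle X under over by fact
  define U where "U = parallel_op X under"
  define V where "V = parallel_op X over"
  have U: "is_parallel_family X under U"
    unfolding U_def by (rule parallel_op_is_parallel_family[OF bij_under bij_diag])
  have bij_diag_over: "bij_betw (\<lambda>x. over x x) X X"
    using bij_diag diag by (simp cong: bij_betw_cong)
  have V: "is_parallel_family X over V"
    unfolding V_def by (rule parallel_op_is_parallel_family[OF bij_over bij_diag_over])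
  \<comment> \<open>The first two laws are those of the biquandle with \<open>y\<close> and
    \<open>z\<close> interchanged and the sides swapped.\<close>
  have exchange:
    "under (under x y) (over z y) = under (under x z) (under y z)"
    "under (over x y) (over z y) = over (under x z) (under y z)"
    "over (over x y) (over z y) = over (over x z) (under y z)"
    if "x \<in> X" "y \<in> X" "z \<in> X" for x y z
    using exchange_uu[OF that(1,3,2)] exchange_uo[OF that(1,3,2)] exchange_oo[OF that] by simp_all
  \<comment> \<open>Conjugation is trivial because the integers are commutative.\<close>
  have conj: "inv\<^bsub>integer_group\<^esub> h \<otimes>\<^bsub>integer_group\<^esub> g \<otimes>\<^bsub>integer_group\<^esub> h = g" for g h
    by simp
  show ?thesis
    unfolding U_def[symmetric] V_def[symmetric]
  proof (intro G_family_of_biquandles.intro G_family_of_biquandles_axioms.intro, unfold conj)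
    show "group integer_group" by simp
    show "X \<noteq> {}" by (rule nonempty)
  next
    fix g h x y z assume "x \<in> X" "y \<in> X" "z \<in> X"
    then show "U h (U g x y) (V g z y) = U g (U h x z) (U h y z)"
      \<comment> \<open>Here and in the next two cases the third and fourth families are
        \<open>V\<close> and \<open>U\<close>. The conditions \<open>exchange_d\<close> and
        \<open>exchange_c\<close> are again exchange laws, with \<open>x = y\<close> and
        \<open>x = z\<close> respectively.\<close>
      by (intro parallel_family_exchange[OF U U V U])
        (rule exchange refl diag diag[symmetric] | assumption)+
  next
    fix g h x y z assume "x \<in> X" "y \<in> X" "z \<in> X"
    then show "U h (V g x y) (V g z y) = V g (U h x z) (U h y z)"
      by (intro parallel_family_exchange[OF V U V U])
        (rule exchange refl diag diag[symmetric] | assumption)+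
  next
    fix g h x y z assume "x \<in> X" "y \<in> X" "z \<in> X"
    then show "V h (V g x y) (V g z y) = V g (V h x z) (U h y z)"
      by (intro parallel_family_exchange[OF V V V U])
        (rule exchange refl diag diag[symmetric] | assumption)+
  qed (simp_all add: parallel_family_simps[OF U] parallel_family_simps[OF V]
      parallel_family_diag_eq[OF U V diag])
qed

end
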